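(* Suppose there is a projective plane of order $q$. Then for integers $n$: (a) $f_2(q+1,n) = q^2+q-1$ whenever $(q-1)^2 < n \leq (q-1)q$; (b) $f_2(q+1,n) = q^2+q$ whenever $(q-1)q < n \leq q^2$.
   Context: Graphs are finite and simple with nonempty vertex set. A clique of a graph is a set of pairwise adjacent vertices (sets with at most one vertex are cliques); a clique is maximal if it is maximal with respect to inclusion, and $c(G)$ is the number of maximal cliques of $G$. For integers $t\geq2$ and $n\geq1$, $f_2(t,n)$ is the minimum of $\sum_{i=1}^t c(G_i)$ over all factorizations of the complete graph $K_n$ into $t$ edge-disjoint spanning subgraphs $G_1,\dots,G_t$ (all on the same $n$ vertices, some possibly edgeless, whose edge sets partition the edge set of $K_n$). A projective plane of order $q$ ($q\ge2$) is the usual finite (nondegenerate) projective plane in which every line has $q+1$ points. *)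

theory Defs
  imports "HOL-Library.Ramsey" "HOL-Library.Disjoint_Sets"
begin

(* A simple graph is a vertex set V with an edge set E \<subseteq> [V]\<^bsup>2\<^esup>, the two-element subsets of V. *)

definition is_clique :: "'a set \<Rightarrow> 'a set set \<Rightarrow> 'a set \<Rightarrow> bool" where
  "is_clique V E S \<longleftrightarrow> S \<subseteq> V \<and> pairwise (\<lambda>u v. {u, v} \<in> E) S"

definition maximal_clique :: "'a set \<Rightarrow> 'a set set \<Rightarrow> 'a set \<Rightarrow> bool" where
  "maximal_clique V E S \<longleftrightarrow>
     is_clique V E S \<and> (\<forall>T. is_clique V E T \<and> S \<subseteq> T \<longrightarrow> T = S)"

definition num_maximal_cliques :: "'a set \<Rightarrow> 'a set set \<Rightarrow> nat" where
  "num_maximal_cliques V E = card {S. maximal_clique V E S}"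

(* The factors are the spanning subgraphs (V, G i), i < t. Edgeless factors are allowed, so the
   edge sets form an indexed family rather than a set of nonempty blocks as in partition_on. *)
definition complete_factorization :: "nat \<Rightarrow> 'a set \<Rightarrow> (nat \<Rightarrow> 'a set set) \<Rightarrow> bool" where
  "complete_factorization t V G \<longleftrightarrow>
     disjoint_family_on G {..<t} \<and> (\<Union>i<t. G i) = [V]\<^bsup>2\<^esup>"

(* K_n has vertex set {..<n}. *)
definition f2 :: "nat \<Rightarrow> nat \<Rightarrow> nat" where
  "f2 t n = (LEAST k. \<exists>G. complete_factorization t {..<n} G \<and>
                          k = (\<Sum>i<t. num_maximal_cliques {..<n} (G i)))"

definition projective_plane :: "'p set \<Rightarrow> 'p set set \<Rightarrow> nat \<Rightarrow> bool" where
  "projective_plane P L q \<longleftrightarrow>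
     finite P \<and> q \<ge> 2 \<and>
     (\<forall>l\<in>L. l \<subseteq> P \<and> card l = q + 1) \<and>
     (\<forall>x\<in>P. \<forall>y\<in>P. x \<noteq> y \<longrightarrow> (\<exists>!l. l \<in> L \<and> x \<in> l \<and> y \<in> l)) \<and>
     (\<forall>l\<in>L. \<forall>m\<in>L. l \<noteq> m \<longrightarrow> (\<exists>!x. x \<in> l \<and> x \<in> m)) \<and>
     (\<exists>Q \<subseteq> P. card Q = 4 \<and> (\<forall>l\<in>L. card (Q \<inter> l) \<le> 2))"

lemma complete_factorization_exists:
  assumes "t \<ge> 1"
  shows "\<exists>G. complete_factorization t V G"
proof
  show "complete_factorization t V (\<lambda>i. if i = 0 then [V]\<^bsup>2\<^esup> else {})"
    using assms
    by (auto simp: complete_factorization_def disjoint_family_on_def split: if_splits)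
qed

lemma f2_attained:
  assumes "t \<ge> 1"
  shows "\<exists>G. complete_factorization t {..<n} G \<and>
             f2 t n = (\<Sum>i<t. num_maximal_cliques {..<n} (G i))"
proof -
  obtain G where "complete_factorization t {..<n} G"
    using complete_factorization_exists[OF assms] by blast
  then show ?thesis
    unfolding f2_def
    by (intro LeastI[of "\<lambda>k. \<exists>G. complete_factorization t {..<n} G \<and>
          k = (\<Sum>i<t. num_maximal_cliques {..<n} (G i))"]) blast
qed

lemma f2_le:
  assumes "complete_factorization t {..<n} G"
  shows "f2 t n \<le> (\<Sum>i<t. num_maximal_cliques {..<n} (G i))"
  unfolding f2_def by (rule Least_le) (use assms in blast)

end

theory Submission
  imports Defs
begin

text \<open>
  Both parts are the case \<open>k = q - 1\<close> or \<open>k = q\<close> of one equation: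
  \<open>f2 (q + 1) n = q\<^sup>2 + k\<close> whenever \<open>(q - 1) * k < n \<le> q * k\<close>.

  Write \<open>c G\<close> for the number of maximal cliques of \<open>G\<close>.

  Lower bound. Give every vertex \<open>v\<close>, in every factor \<open>G i\<close>, a maximal clique \<open>\<phi> i v\<close>
  containing it. If two vertices get the same clique in \<open>G i\<close>, then they are adjacent in \<open>G i\<close>, and
  this happens in only one factor. Hence \<open>v \<mapsto> (\<phi> i v, \<phi> j v)\<close> is injective for \<open>i \<noteq> j\<close>,
  and any two factors satisfy \<open>n \<le> c (G i) * c (G j)\<close>
  (\<open>card_le_num_maximal_cliques_times\<close>). So at most one factor can have few
  maximal cliques, and the fewer it has, the more each other factor must have; weighing
  this yields the bound on the sum (\<open>sum_lower_bound\<close>).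

  Upper bound. Delete a line \<open>l\<^sub>0\<close> from the plane. The remaining \<open>q\<^sup>2\<close> points form an
  affine plane whose \<open>q + 1\<close> parallel classes correspond to the points of \<open>l\<^sub>0\<close>, each class
  having \<open>q\<close> lines. Placing the \<open>n\<close> vertices injectively on affine points and joining two of
  them in the factor of \<open>y \<in> l\<^sub>0\<close> when their line passes through \<open>y\<close> makes each
  factor a disjoint union of complete graphs, one for each occupied line of the class. If the vertices
  are placed on \<open>k\<close> lines of one class, which have room for \<open>q * k\<close> vertices, then
  this class contributes at most \<open>k\<close> and the others at most \<open>q\<close> each
  (\<open>f2_upper_bound\<close>).
\<close>

section \<open>Maximal cliques and the lower bound\<close>

lemma finite_maximal_cliques: "finite V \<Longrightarrow> finite {S. maximal_clique V E S}"
  by (rule finite_subset[of _ "Pow V"]) (auto simp: maximal_clique_def is_clique_def)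

lemma ex_maximal_clique_containing:
  assumes "finite V" "v \<in> V"
  shows "\<exists>S. maximal_clique V E S \<and> v \<in> S"
proof -
  have "finite {S. is_clique V E S}"
    by (rule finite_subset[of _ "Pow V"]) (use assms in \<open>auto simp: is_clique_def\<close>)
  moreover have "{v} \<in> {S. is_clique V E S}"
    using assms by (simp add: is_clique_def)
  ultimately obtain S where "is_clique V E S" "v \<in> S"
    and "\<And>T. is_clique V E T \<Longrightarrow> S \<subseteq> T \<Longrightarrow> S = T"
    using finite_has_maximal2[of "{S. is_clique V E S}" "{v}"] by auto
  then have "maximal_clique V E S"
    unfolding maximal_clique_def by metis
  then show ?thesis using \<open>v \<in> S\<close> by blast
qed

lemma adjacent_if_same_clique:
  "\<lbrakk>maximal_clique V E S; u \<in> S; v \<in> S; u \<noteq> v\<rbrakk> \<Longrightarrow> {u, v} \<in> E"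
  by (auto simp: maximal_clique_def is_clique_def pairwise_def)

text \<open>
  Edge-disjointness makes a vertex recoverable from the pair of its chosen maximal cliques in two
  factors: two vertices sharing both cliques would be adjacent in both factors.
\<close>

lemma card_le_num_maximal_cliques_times:
  assumes "finite V" "E \<inter> F = {}"
  shows "card V \<le> num_maximal_cliques V E * num_maximal_cliques V F"
proof -
  obtain \<phi> \<psi> where \<phi>: "\<And>v. v \<in> V \<Longrightarrow> maximal_clique V E (\<phi> v) \<and> v \<in> \<phi> v"
    and \<psi>: "\<And>v. v \<in> V \<Longrightarrow> maximal_clique V F (\<psi> v) \<and> v \<in> \<psi> v"
    using ex_maximal_clique_containing[OF \<open>finite V\<close>, of _ E]
      ex_maximal_clique_containing[OF \<open>finite V\<close>, of _ F] by metis
  let ?C = "{S. maximal_clique V E S} \<times> {S. maximal_clique V F S}"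
  have "inj_on (\<lambda>v. (\<phi> v, \<psi> v)) V"
  proof (rule inj_onI, rule ccontr)
    fix u v
    assume uv: "u \<in> V" "v \<in> V" "(\<phi> u, \<psi> u) = (\<phi> v, \<psi> v)" "u \<noteq> v"
    then have "{u, v} \<in> E" "{u, v} \<in> F"
      using \<phi>[of u] \<phi>[of v] \<psi>[of u] \<psi>[of v] adjacent_if_same_clique by auto
    then show False using assms by blast
  qed
  moreover have "(\<lambda>v. (\<phi> v, \<psi> v)) ` V \<subseteq> ?C"
    using \<phi> \<psi> by auto
  moreover have "finite ?C"
    using assms finite_maximal_cliques by blast
  ultimately have "card V \<le> card ?C"
    by (rule card_inj_on_le)
  then show ?thesis
    by (simp add: num_maximal_cliques_def card_cartesian_product)
qed

text \<open>
  A value below \<open>q\<close> forces all the other \<open>q\<close> values to be large. For \<open>k = q - 1\<close> the extremal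
  case is one value \<open>q - 1\<close> with all others equal to \<open>q\<close>; a value of at most \<open>q - 2\<close>
  already pushes the others above \<open>q\<close>, because \<open>(q - 2) * q < (q - 1)\<^sup>2\<close>.
\<close>

lemma sum_lower_bound:
  fixes c :: "nat \<Rightarrow> nat"
  assumes prod: "\<And>i j. \<lbrakk>i \<le> q; j \<le> q; i \<noteq> j\<rbrakk> \<Longrightarrow> (q - 1) * k < c i * c j"
    and k: "k = q - 1 \<or> k = q" and "q \<ge> 1"
  shows "q^2 + k \<le> (\<Sum>i\<le>q. c i)"
proof (cases "\<forall>i\<le>q. q \<le> c i")
  case True
  have "q^2 + k \<le> (\<Sum>i\<le>q. q)"
    using k by (auto simp: power2_eq_square)
  also have "\<dots> \<le> (\<Sum>i\<le>q. c i)"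
    using True by (intro sum_mono) auto
  finally show ?thesis .
next
  case False
  then obtain i where i: "i \<le> q" "c i \<le> q - 1" by force
  have others: "q * b + c i \<le> (\<Sum>j\<le>q. c j)"
    if "\<And>j. \<lbrakk>j \<le> q; j \<noteq> i\<rbrakk> \<Longrightarrow> b \<le> c j" for b
  proof -
    have "q * b = (\<Sum>j\<in>{..q} - {i}. b)" using i by simp
    also have "\<dots> \<le> (\<Sum>j\<in>{..q} - {i}. c j)" using that by (intro sum_mono) auto
    finally show ?thesis using i by (simp add: sum.remove[of "{..q}" i])
  qed
  have large: "a < c j" if "j \<le> q" "j \<noteq> i" "c i * a \<le> (q - 1) * k" for j a
  proof -
    have "c i * a < c i * c j" using prod[of i j] that i by linarith
    then show ?thesis by simp
  qed
  show ?thesis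
  proof (cases "k = q \<or> c i \<noteq> q - 1")
    case True
    have "c i * q \<le> (q - 1) * k"
    proof (cases "k = q")
      case False
      then have "c i \<le> q - 2" "k = q - 1" using True k i by auto
      then have "c i * q \<le> (q - 2) * q" by simp
      also have "\<dots> \<le> (q - 1) * (q - 1)"
      proof (cases "q \<ge> 2")
        case True
        then obtain r where "q = r + 2" by (metis add.commute le_Suc_ex)
        then show ?thesis by simp
      qed simp
      finally show ?thesis using \<open>k = q - 1\<close> by simp
    qed (use i in simp)
    then have "q * (q + 1) + c i \<le> (\<Sum>j\<le>q. c j)"
      using large by (intro others) (simp add: Suc_le_eq)
    then show ?thesis using k by (auto simp: power2_eq_square)
  next
    case False
    then have "k = q - 1" "c i = k" using k by auto
    then have "q * q + c i \<le> (\<Sum>j\<le>q. c j)"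
      using large[of _ "q - 1"] by (intro others) fastforce
    then show ?thesis using \<open>c i = k\<close> by (simp add: power2_eq_square)
  qed
qed

lemma f2_lower_bound:
  assumes "(q - 1) * k < n" "k = q - 1 \<or> k = q" "q \<ge> 1"
  shows "q^2 + k \<le> f2 (q + 1) n"
proof -
  obtain G where G: "complete_factorization (q + 1) {..<n} G"
    and f2: "f2 (q + 1) n = (\<Sum>i<q + 1. num_maximal_cliques {..<n} (G i))"
    using f2_attained[of "q + 1" n] by auto
  have "q^2 + k \<le> (\<Sum>i\<le>q. num_maximal_cliques {..<n} (G i))"
  proof (rule sum_lower_bound)
    fix i j assume ij: "i \<le> q" "j \<le> q" "i \<noteq> j"
    then have "G i \<inter> G j = {}"
      using G by (auto simp: complete_factorization_def disjoint_family_on_def)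
    then have "n \<le> num_maximal_cliques {..<n} (G i) * num_maximal_cliques {..<n} (G j)"
      using card_le_num_maximal_cliques_times[of "{..<n}" "G i" "G j"] by simp
    then show "(q - 1) * k < num_maximal_cliques {..<n} (G i) * num_maximal_cliques {..<n} (G j)"
      using assms(1) by linarith
  qed (use assms in auto)
  then show ?thesis
    unfolding f2 by (simp add: lessThan_Suc_atMost)
qed

section \<open>Pencils of lines in a projective plane\<close>

locale proj_plane =
  fixes P :: "'p set" and L :: "'p set set" and q :: nat
  assumes plane: "projective_plane P L q"
begin

lemma finite_points: "finite P"
  and line_subset: "l \<in> L \<Longrightarrow> l \<subseteq> P"
  and card_line: "l \<in> L \<Longrightarrow> card l = q + 1"
  and ex1_line: "\<lbrakk>x \<in> P; y \<in> P; x \<noteq> y\<rbrakk> \<Longrightarrow> \<exists>!l. l \<in> L \<and> x \<in> l \<and> y \<in> l"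
  and ex1_point: "\<lbrakk>l \<in> L; m \<in> L; l \<noteq> m\<rbrakk> \<Longrightarrow> \<exists>!x. x \<in> l \<and> x \<in> m"
  and quadrangle: "\<exists>Q \<subseteq> P. card Q = 4 \<and> (\<forall>l\<in>L. card (Q \<inter> l) \<le> 2)"
  using plane unfolding projective_plane_def by simp_all

lemma finite_line: "l \<in> L \<Longrightarrow> finite l"
  using finite_points line_subset finite_subset by blast

lemma finite_lines: "finite L"
  by (rule finite_subset[of _ "Pow P"]) (use finite_points line_subset in auto)

lemma line_through:
  assumes "x \<in> P" "y \<in> P" "x \<noteq> y"
  obtains l where "l \<in> L" "x \<in> l" "y \<in> l"
  using ex1_line[OF assms] by blast

lemma line_unique:
  assumes "l \<in> L" "m \<in> L" "x \<in> l" "y \<in> l" "x \<in> m" "y \<in> m" "x \<noteq> y"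
  shows "l = m"
  using ex1_line[of x y] assms line_subset by blast

lemma lines_meet:
  assumes "l \<in> L" "m \<in> L"
  obtains x where "x \<in> l" "x \<in> m"
proof (cases "l = m")
  case True
  then have "l \<noteq> {}" using card_line assms by fastforce
  then show ?thesis using that True by blast
next
  case False
  then show ?thesis using that ex1_point[OF assms] by blast
qed

lemma three_noncollinear_points:
  obtains a b c where "a \<in> P" "b \<in> P" "c \<in> P" "a \<noteq> x" "b \<noteq> x" "c \<noteq> x"
    "a \<noteq> b" "b \<noteq> c" "a \<noteq> c" "\<And>l. l \<in> L \<Longrightarrow> \<not> (a \<in> l \<and> b \<in> l \<and> c \<in> l)"
proof -
  obtain Q where Q: "Q \<subseteq> P" "card Q = 4" "\<forall>l\<in>L. card (Q \<inter> l) \<le> 2"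
    using quadrangle by blast
  have "finite Q" using Q finite_points finite_subset by blast
  then have "3 \<le> card (Q - {x})"
    using Q by (simp add: card_Diff_singleton_if)
  then obtain T where T: "T \<subseteq> Q - {x}" "card T = 3"
    by (rule obtain_subset_with_card_n)
  then obtain a b c where abc: "T = {a, b, c}" "a \<noteq> b" "b \<noteq> c" "a \<noteq> c"
    by (auto simp: card_3_iff)
  have "\<not> (a \<in> l \<and> b \<in> l \<and> c \<in> l)" if "l \<in> L" for l
  proof
    assume "a \<in> l \<and> b \<in> l \<and> c \<in> l"
    then have "T \<subseteq> Q \<inter> l" using abc T by auto
    then have "3 \<le> card (Q \<inter> l)"
      using T \<open>finite Q\<close> card_mono by (metis finite_Int)
    then show False using Q that by fastforce
  qed
  then show ?thesis using that[of a b c] abc T Q by auto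
qed

lemma line_avoiding:
  obtains l where "l \<in> L" "x \<notin> l"
proof -
  obtain a b c where abc: "a \<in> P" "b \<in> P" "c \<in> P" "b \<noteq> x" "a \<noteq> b" "b \<noteq> c"
    "\<And>l. l \<in> L \<Longrightarrow> \<not> (a \<in> l \<and> b \<in> l \<and> c \<in> l)"
    by (rule three_noncollinear_points[of x]) metis
  obtain l where l: "l \<in> L" "a \<in> l" "b \<in> l" using abc line_through by metis
  obtain m where m: "m \<in> L" "b \<in> m" "c \<in> m" using abc line_through by metis
  \<comment> \<open>Otherwise both sides of the triangle at \<open>b\<close> would be the line joining \<open>b\<close> and \<open>x\<close>.\<close>
  have "x \<notin> l \<or> x \<notin> m"
    using line_unique[of l m b x] l m abc by blast
  then show ?thesis using that l m by blast
qed

definition pencil :: "'p \<Rightarrow> 'p set set" where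
  "pencil x = {l \<in> L. x \<in> l}"

text \<open>
  Projection from \<open>x\<close> identifies the lines through \<open>x\<close> with the points of a line avoiding \<open>x\<close>.
\<close>

lemma card_pencil:
  assumes "x \<in> P"
  shows "card (pencil x) = q + 1"
proof -
  obtain l where l: "l \<in> L" "x \<notin> l" by (rule line_avoiding)
  have "\<forall>y\<in>l. \<exists>m. m \<in> L \<and> x \<in> m \<and> y \<in> m"
    using line_through assms l line_subset by (metis subsetD)
  then obtain h where h: "\<And>y. y \<in> l \<Longrightarrow> h y \<in> L \<and> x \<in> h y \<and> y \<in> h y" by metis
  have "inj_on h l"
  proof (rule inj_onI, rule ccontr)
    fix y z assume yz: "y \<in> l" "z \<in> l" "h y = h z" "y \<noteq> z"
    then have "h y = l" using line_unique[of "h y" l y z] h l by metis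
    then show False using h yz l by metis
  qed
  moreover have "h ` l = pencil x"
  proof
    show "h ` l \<subseteq> pencil x" using h by (auto simp: pencil_def)
    show "pencil x \<subseteq> h ` l"
    proof
      fix m assume m: "m \<in> pencil x"
      then obtain y where y: "y \<in> m" "y \<in> l" using lines_meet l by (auto simp: pencil_def)
      then have "m = h y"
        using line_unique[of m "h y" x y] h[of y] l m by (auto simp: pencil_def)
      then show "m \<in> h ` l" using y by blast
    qed
  qed
  ultimately show ?thesis using card_image card_line l by metis
qed

lemma finite_pencil: "finite (pencil x)"
  using finite_lines by (simp add: pencil_def)

lemma card_pencil_points:
  assumes "M \<subseteq> pencil x"
  shows "card (\<Union>m\<in>M. m - {x}) = q * card M"
proof -
  have "card (\<Union>m\<in>M. m - {x}) = (\<Sum>m\<in>M. card (m - {x}))"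
  proof (rule card_UN_disjoint)
    show "finite M" using assms finite_pencil finite_subset by blast
    show "\<forall>m\<in>M. finite (m - {x})" using assms finite_line by (auto simp: pencil_def)
    show "\<forall>m\<in>M. \<forall>m'\<in>M. m \<noteq> m' \<longrightarrow> (m - {x}) \<inter> (m' - {x}) = {}"
    proof (intro ballI impI equals0I)
      fix m m' y
      assume "m \<in> M" "m' \<in> M" "m \<noteq> m'" "y \<in> (m - {x}) \<inter> (m' - {x})"
      then show False
        using line_unique[of m m' x y] assms by (auto simp: pencil_def)
    qed
  qed
  also have "\<dots> = (\<Sum>m\<in>M. q)"
    using assms card_line finite_line by (intro sum.cong) (auto simp: pencil_def)
  finally show ?thesis by simp
qed

section \<open>Factorizations from parallel classes\<close>

text \<open>
  Here \<open>f\<close> places the vertices in the plane. When \<open>y\<close> lies on the deleted line, the other lines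
  through \<open>y\<close> form one parallel class of the affine plane, and these are the edges of its factor.
\<close>

definition class_edges :: "nat set \<Rightarrow> (nat \<Rightarrow> 'p) \<Rightarrow> 'p \<Rightarrow> nat set set" where
  "class_edges V f y = {{u, v} |u v. u \<in> V \<and> v \<in> V \<and> u \<noteq> v \<and> (\<exists>m\<in>pencil y. f u \<in> m \<and> f v \<in> m)}"

lemma class_edges_iff:
  "{u, v} \<in> class_edges V f y \<longleftrightarrow>
     u \<in> V \<and> v \<in> V \<and> u \<noteq> v \<and> (\<exists>m\<in>pencil y. f u \<in> m \<and> f v \<in> m)"
  unfolding class_edges_def by (auto simp: doubleton_eq_iff)

text \<open>
  Away from \<open>y\<close>, lying on a common line through \<open>y\<close> is an equivalence relation, so the maximal
  cliques are the sets of vertices on the occupied lines through \<open>y\<close>.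
\<close>

lemma num_maximal_cliques_class_edges_le:
  assumes V: "V \<noteq> {}" and M: "M \<subseteq> pencil y"
    and cover: "\<And>v. v \<in> V \<Longrightarrow> \<exists>m\<in>M. f v \<in> m"
    and inj: "inj_on f V" and off: "y \<notin> f ` V"
  shows "num_maximal_cliques V (class_edges V f y) \<le> card M"
proof -
  let ?E = "class_edges V f y"
  have "{S. maximal_clique V ?E S} \<subseteq> (\<lambda>m. {v\<in>V. f v \<in> m}) ` M"
  proof
    fix S assume "S \<in> {S. maximal_clique V ?E S}"
    then have S: "is_clique V ?E S" and max: "\<And>T. is_clique V ?E T \<Longrightarrow> S \<subseteq> T \<Longrightarrow> T = S"
      unfolding maximal_clique_def by auto
    have "S \<noteq> {}"
    proof
      assume "S = {}"
      moreover obtain w where "w \<in> V" using V by blast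
      ultimately show False using max[of "{w}"] by (simp add: is_clique_def)
    qed
    then obtain u where u: "u \<in> S" "u \<in> V" using S by (auto simp: is_clique_def)
    obtain m where m: "m \<in> M" "f u \<in> m" using cover u by blast
    have "is_clique V ?E {v\<in>V. f v \<in> m}"
      using M m by (auto simp: is_clique_def pairwise_def class_edges_iff)
    moreover have "S \<subseteq> {v\<in>V. f v \<in> m}"
    proof
      fix v assume v: "v \<in> S"
      then have vV: "v \<in> V" using S by (auto simp: is_clique_def)
      show "v \<in> {v\<in>V. f v \<in> m}"
      proof (cases "v = u")
        case False
        then have "{u, v} \<in> ?E" using S u v by (auto simp: is_clique_def pairwise_def)
        then obtain m' where m': "m' \<in> pencil y" "f u \<in> m'" "f v \<in> m'"
          by (auto simp: class_edges_iff)
        moreover have "f u \<noteq> y" using off u by blast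
        ultimately have "m' = m"
          using line_unique[of m' m y "f u"] m M by (auto simp: pencil_def)
        then show ?thesis using m' vV by simp
      qed (use m vV in simp)
    qed
    ultimately have "{v\<in>V. f v \<in> m} = S" by (rule max)
    then show "S \<in> (\<lambda>m. {v\<in>V. f v \<in> m}) ` M" using m by blast
  qed
  moreover have "finite M" using M finite_pencil finite_subset by blast
  ultimately show ?thesis
    unfolding num_maximal_cliques_def by (rule surj_card_le[rotated])
qed

text \<open>
  The line joining two affine points meets the deleted line in exactly one point; this point names
  the factor that contains the edge.
\<close>

lemma complete_factorization_class_edges:
  assumes l0: "l0 \<in> L" and g: "bij_betw g {..<t} l0"
    and f: "inj_on f V" "f ` V \<subseteq> P - l0"
  shows "complete_factorization t V (\<lambda>i. class_edges V f (g i))"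
  unfolding complete_factorization_def
proof
  show "disjoint_family_on (\<lambda>i. class_edges V f (g i)) {..<t}"
    unfolding disjoint_family_on_def
  proof (intro ballI impI equals0I)
    fix i j e
    assume ij: "i \<in> {..<t}" "j \<in> {..<t}" "i \<noteq> j"
      and e: "e \<in> class_edges V f (g i) \<inter> class_edges V f (g j)"
    obtain u v where uv: "e = {u, v}" using e unfolding class_edges_def by blast
    obtain m m' where m: "m \<in> pencil (g i)" "f u \<in> m" "f v \<in> m"
      and m': "m' \<in> pencil (g j)" "f u \<in> m'" "f v \<in> m'" and uv': "u \<in> V" "v \<in> V" "u \<noteq> v"
      using e unfolding uv by (auto simp: class_edges_iff)
    have "f u \<noteq> f v" using f uv' by (auto simp: inj_on_def)
    then have "m = m'"
      using line_unique[of m m' "f u" "f v"] m m' by (auto simp: pencil_def)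
    moreover have "g i \<noteq> g j" "g i \<in> l0" "g j \<in> l0"
      using g ij by (auto simp: bij_betw_def inj_on_def)
    ultimately have "m = l0"
      using line_unique[of m l0 "g i" "g j"] m m' l0 by (auto simp: pencil_def)
    then show False using m f uv' by blast
  qed
  show "(\<Union>i<t. class_edges V f (g i)) = [V]\<^bsup>2\<^esup>"
  proof
    show "(\<Union>i<t. class_edges V f (g i)) \<subseteq> [V]\<^bsup>2\<^esup>"
      by (auto simp: class_edges_def nsets_def card_2_iff)
    show "[V]\<^bsup>2\<^esup> \<subseteq> (\<Union>i<t. class_edges V f (g i))"
    proof
      fix e assume "e \<in> [V]\<^bsup>2\<^esup>"
      then obtain u v where uv: "e = {u, v}" "u \<noteq> v" "u \<in> V" "v \<in> V"
        by (auto simp: nsets_def card_2_iff)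
      then have "f u \<noteq> f v" "f u \<in> P" "f v \<in> P" using f by (auto simp: inj_on_def)
      then obtain m where m: "m \<in> L" "f u \<in> m" "f v \<in> m" using line_through by blast
      obtain y where y: "y \<in> m" "y \<in> l0" using lines_meet m l0 by blast
      then obtain i where i: "i < t" "y = g i" using g by (auto simp: bij_betw_def)
      have "e \<in> class_edges V f (g i)"
        using uv m y i by (auto simp: class_edges_iff pencil_def)
      then show "e \<in> (\<Union>i<t. class_edges V f (g i))" using i by blast
    qed
  qed
qed

lemma f2_upper_bound:
  assumes "k \<le> q" "1 \<le> n" "n \<le> q * k"
  shows "f2 (q + 1) n \<le> q^2 + k"
proof -
  obtain l0 where l0: "l0 \<in> L" by (rule line_avoiding)
  obtain g where g: "bij_betw g {..<q + 1} l0"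
    using ex_bij_betw_nat_finite[OF finite_line[OF l0]] card_line[OF l0]
    by (metis atLeast0LessThan)
  have gl: "g i \<in> l0" "g i \<in> P" if "i < q + 1" for i
    using g that l0 line_subset by (auto simp: bij_betw_def)
  have classes: "card (pencil (g i) - {l0}) = q" if "i < q + 1" for i
    using card_pencil gl[OF that] l0 by (simp add: pencil_def)
  \<comment> \<open>The class of the last index is the one of which only \<open>k\<close> lines are occupied.\<close>
  have "k \<le> card (pencil (g q) - {l0})" using classes[of q] assms by simp
  then obtain M where M: "M \<subseteq> pencil (g q) - {l0}" "card M = k"
    by (rule obtain_subset_with_card_n)
  let ?A = "\<Union>m\<in>M. m - {g q}"
  have cardA: "n \<le> card ?A" using card_pencil_points[of M "g q"] M assms by (metis Diff_subset order_trans)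
  have AP: "?A \<subseteq> P - l0"
  proof
    fix p assume "p \<in> ?A"
    then obtain m where m: "m \<in> M" "p \<in> m" "p \<noteq> g q" by blast
    then have "m \<in> L" "g q \<in> m" "m \<noteq> l0" using M by (auto simp: pencil_def)
    then show "p \<in> P - l0"
      using line_unique[of m l0 p "g q"] m l0 gl[of q] line_subset by auto
  qed
  then have "finite ?A" using finite_points finite_subset by blast
  then obtain f where f: "inj_on f {..<n}" "f ` {..<n} \<subseteq> ?A"
    using card_le_inj[of "{..<n}" ?A] cardA by auto
  let ?G = "\<lambda>i. class_edges {..<n} f (g i)"
  have fP: "f v \<in> P - l0" if "v < n" for v using f AP that by blast
  have off: "g i \<notin> f ` {..<n}" if "i < q + 1" for i
    using gl[OF that] fP by auto
  have "num_maximal_cliques {..<n} (?G i) \<le> q" if i: "i < q + 1" for i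
  proof -
    have "num_maximal_cliques {..<n} (?G i) \<le> card (pencil (g i) - {l0})"
    proof (rule num_maximal_cliques_class_edges_le)
      fix v assume "v \<in> {..<n}"
      then have v: "f v \<in> P - l0" using fP by simp
      then have "f v \<noteq> g i" using gl[OF i] by auto
      then obtain m where "m \<in> L" "f v \<in> m" "g i \<in> m"
        using line_through[of "f v" "g i"] v gl[OF i] by blast
      then show "\<exists>m\<in>pencil (g i) - {l0}. f v \<in> m"
        using v by (auto simp: pencil_def)
    qed (use assms f off[OF i] in \<open>auto simp: lessThan_empty_iff\<close>)
    then show ?thesis using classes[OF i] by simp
  qed
  then have "(\<Sum>i<q. num_maximal_cliques {..<n} (?G i)) \<le> (\<Sum>i<q. q)"
    by (intro sum_mono) auto
  moreover have "num_maximal_cliques {..<n} (?G q) \<le> card M"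
    by (rule num_maximal_cliques_class_edges_le)
      (use assms f M off[of q] in \<open>auto simp: lessThan_empty_iff\<close>)
  moreover have "f2 (q + 1) n \<le> (\<Sum>i<q + 1. num_maximal_cliques {..<n} (?G i))"
    using complete_factorization_class_edges[OF l0 g] f AP by (intro f2_le) blast
  ultimately show ?thesis using M by (simp add: power2_eq_square)
qed

end

section \<open>The exact values\<close>

theorem theorem19:
  fixes P :: "'p set" and L :: "'p set set" and q :: nat
  assumes "projective_plane P L q"
  shows "(\<forall>n::nat. (q - 1)^2 < n \<and> n \<le> (q - 1) * q \<longrightarrow> f2 (q + 1) n = q^2 + q - 1) \<and>
         (\<forall>n::nat. (q - 1) * q < n \<and> n \<le> q^2 \<longrightarrow> f2 (q + 1) n = q^2 + q)"
proof -
  interpret proj_plane P L q by unfold_locales (fact assms)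
  have "q \<ge> 2" using assms by (simp add: projective_plane_def)
  have exact: "f2 (q + 1) n = q^2 + k"
    if "k = q - 1 \<or> k = q" "(q - 1) * k < n" "n \<le> q * k" for n k
    using f2_upper_bound[of k n] f2_lower_bound[of q k n] that \<open>q \<ge> 2\<close>
    by (intro antisym) auto
  show ?thesis
    using exact[of "q - 1"] exact[of q] \<open>q \<ge> 2\<close>
    by (auto simp: power2_eq_square mult.commute)
qed

end
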